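(* Let $n\ge 1$, let $P$ be a finite partially ordered set, let $R$ be a partially ordered set, and let $\psi:P\times[n]\to R$ be an isotone map which has left strict chain fibers. Let $\psi_1:\langle x_{P\times[n]}\rangle\to\langle x_R\rangle$ be the linear map with $x_{p,i}\mapsto x_{\psi(p,i)}$, and let $B$ be a basis of $\ker\psi_1$ consisting of differences $x_{p,i}-x_{p',i'}$ with $\psi(p,i)=\psi(p',i')$. Then $B$ is a regular sequence for the ring $\Bbbk[x_{P\times[n]}]/L(P,n)$.
   Context: $\Bbbk$ is a field and $[n]=\{1<2<\cdots<n\}$ is the chain on $n$ elements. For a set $A$, $\Bbbk[x_A]$ is the polynomial ring in variables $x_a$, $a\in A$, and $\langle x_A\rangle$ is the $\Bbbk$-vector space spanned by these variables. A map of posets is isotone if it is order preserving; $\mathrm{Hom}(P,[n])$ is the set of isotone maps $P\to[n]$. Products of posets carry the componentwise order, and $[n]^{op}$ is the opposite poset of $[n]$. The $n$'th co-letterplace ideal $L(P,n)\subseteq\Bbbk[x_{P\times[n]}]$ is generated by all monomials $\prod_{p\in P}x_{p,\phi(p)}$ with $\phi\in\mathrm{Hom}(P,[n])$. A chain in a product of posets $Q\times Q'$ is left strict if for any two of its elements, $(a,b)<(a',b')$ implies $a<a'$. An isotone map $\psi:P\times[n]\to R$ has left strict chain fibers if every fiber $\psi^{-1}(r)$ is a left strict chain in $P\times[n]^{op}$. A sequence of elements is regular for a ring if each element is a nonzerodivisor on the quotient of the ring by the preceding elements (the elements here are homogeneous of degree one, so the quotient of a nonzero graded quotient ring by them is automatically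 nonzero). *)

theory Defs
  imports
    Complex_Main
    "HOL-Algebra.Order"
    "HOL-Algebra.QuotRing"
    "HOL-Library.FuncSet"
    "HOL-Library.Poly_Mapping"
begin

section \<open>Posets\<close>

text \<open>Posets are HOL-Algebra order structures satisfying \<^locale>\<open>partial_order\<close>.\<close>

definition nat_chain :: "nat \<Rightarrow> nat gorder"
  where "nat_chain n = \<lparr>carrier = {1..n}, eq = (=), le = (\<le>)\<rparr>"

definition prod_order :: "'a gorder \<Rightarrow> 'b gorder \<Rightarrow> ('a \<times> 'b) gorder"
  where "prod_order Q Q' =
    \<lparr>carrier = carrier Q \<times> carrier Q', eq = (=),
     le = (\<lambda>x y. fst x \<sqsubseteq>\<^bsub>Q\<^esub> fst y \<and> snd x \<sqsubseteq>\<^bsub>Q'\<^esub> snd y)\<rparr>"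

lemma partial_order_nat_chain: "partial_order (nat_chain n)"
  by unfold_locales (auto simp: nat_chain_def)

lemma partial_order_prod_order:
  assumes "partial_order Q" "partial_order Q'"
  shows "partial_order (prod_order Q Q')"
proof -
  interpret Q: partial_order Q by fact
  interpret Q': partial_order Q' by fact
  show ?thesis
  proof
    fix x y z
    assume "x \<sqsubseteq>\<^bsub>prod_order Q Q'\<^esub> y" "y \<sqsubseteq>\<^bsub>prod_order Q Q'\<^esub> z"
      "x \<in> carrier (prod_order Q Q')" "y \<in> carrier (prod_order Q Q')" "z \<in> carrier (prod_order Q Q')"
    then show "x \<sqsubseteq>\<^bsub>prod_order Q Q'\<^esub> z"
      using Q.le_trans[of "fst x" "fst y" "fst z"] Q'.le_trans[of "snd x" "snd y" "snd z"]
      by (simp add: prod_order_def mem_Times_iff)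
  qed (simp_all add: prod_order_def mem_Times_iff prod_eq_iff Q.le_antisym Q'.le_antisym)
qed

text \<open>Isotone maps, as extensional functions, so that this is really a set of maps from the
  carrier of \<open>Q\<close> to the carrier of \<open>Q'\<close>.\<close>

definition Hom_poset :: "'a gorder \<Rightarrow> 'b gorder \<Rightarrow> ('a \<Rightarrow> 'b) set"
  where "Hom_poset Q Q' = {\<phi> \<in> carrier Q \<rightarrow>\<^sub>E carrier Q'. isotone Q Q' \<phi>}"

definition is_chain :: "'a gorder \<Rightarrow> 'a set \<Rightarrow> bool"
  where "is_chain Q C \<longleftrightarrow> C \<subseteq> carrier Q \<and> (\<forall>x\<in>C. \<forall>y\<in>C. x \<sqsubseteq>\<^bsub>Q\<^esub> y \<or> y \<sqsubseteq>\<^bsub>Q\<^esub> x)"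

definition left_strict_chain :: "'a gorder \<Rightarrow> 'b gorder \<Rightarrow> ('a \<times> 'b) set \<Rightarrow> bool"
  where "left_strict_chain Q Q' C \<longleftrightarrow>
    is_chain (prod_order Q Q') C \<and>
    (\<forall>(a, b)\<in>C. \<forall>(a', b')\<in>C. (a, b) \<sqsubset>\<^bsub>prod_order Q Q'\<^esub> (a', b') \<longrightarrow> a \<sqsubset>\<^bsub>Q\<^esub> a')"

definition left_strict_chain_fibers ::
  "'p gorder \<Rightarrow> nat \<Rightarrow> 'r gorder \<Rightarrow> ('p \<times> nat \<Rightarrow> 'r) \<Rightarrow> bool"
  where "left_strict_chain_fibers P n R \<psi> \<longleftrightarrow>
    (\<forall>r\<in>carrier R. left_strict_chain P (inv_gorder (nat_chain n))
        {x \<in> carrier (prod_order P (nat_chain n)). \<psi> x = r})"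


section \<open>Polynomials\<close>

text \<open>A monomial is a finitely supported exponent function, and a polynomial is a finitely supported
  function from monomials to coefficients; multiplication is convolution.\<close>

type_synonym ('v, 'k) mpoly = "('v \<Rightarrow>\<^sub>0 nat) \<Rightarrow>\<^sub>0 'k"

definition var :: "'v \<Rightarrow> ('v, 'k::field) mpoly"
  where "var a = Poly_Mapping.single (Poly_Mapping.single a 1) 1"

definition scale_poly :: "'k \<Rightarrow> ('v, 'k::field) mpoly \<Rightarrow> ('v, 'k) mpoly"
  where "scale_poly c f = Poly_Mapping.single 0 c * f"

text \<open>The ring of polynomials whose variables all lie in the set \<open>A\<close>.\<close>

definition poly_ring :: "'v set \<Rightarrow> ('v, 'k::field) mpoly ring"
  where "poly_ring A =
    \<lparr>carrier = {f. \<forall>m\<in>Poly_Mapping.keys f. Poly_Mapping.keys m \<subseteq> A},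
     mult = (*), one = 1, zero = 0, add = (+)\<rparr>"

lemma cring_poly_ring: "cring (poly_ring A :: ('v, 'k::field) mpoly ring)"
proof (rule cringI)
  let ?R = "poly_ring A :: ('v, 'k) mpoly ring"
  have simps: "x \<oplus>\<^bsub>?R\<^esub> y = x + y" "x \<otimes>\<^bsub>?R\<^esub> y = x * y" "\<zero>\<^bsub>?R\<^esub> = 0" "\<one>\<^bsub>?R\<^esub> = 1" for x y
    by (simp_all add: poly_ring_def)
  have zero: "0 \<in> carrier ?R" and one: "1 \<in> carrier ?R"
    by (simp_all add: poly_ring_def)
  have minus: "- f \<in> carrier ?R" if "f \<in> carrier ?R" for f
    using that by (simp add: poly_ring_def)
  have add: "f + g \<in> carrier ?R" if "f \<in> carrier ?R" "g \<in> carrier ?R" for f g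
    using that Poly_Mapping.keys_add[of f g] by (auto simp: poly_ring_def)
  have mult: "f * g \<in> carrier ?R" if fg: "f \<in> carrier ?R" "g \<in> carrier ?R" for f g
  proof -
    have "Poly_Mapping.keys m \<subseteq> A" if m: "m \<in> Poly_Mapping.keys (f * g)" for m
    proof -
      obtain a b where ab: "m = a + b" "a \<in> Poly_Mapping.keys f" "b \<in> Poly_Mapping.keys g"
        using subsetD[OF keys_mult m] by blast
      then have "Poly_Mapping.keys a \<subseteq> A" "Poly_Mapping.keys b \<subseteq> A"
        using fg by (auto simp: poly_ring_def)
      then show ?thesis
        unfolding ab(1) by (rule order_trans[OF Poly_Mapping.keys_add Un_least])
    qed
    then show ?thesis by (simp add: poly_ring_def)
  qed
  show "abelian_group ?R"
  proof (rule abelian_groupI)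
    fix f assume f: "f \<in> carrier ?R"
    show "\<exists>g\<in>carrier ?R. g \<oplus>\<^bsub>?R\<^esub> f = \<zero>\<^bsub>?R\<^esub>"
      by (rule bexI[OF _ minus[OF f]]) (simp add: simps)
  qed (simp_all add: simps zero add add_ac)
  show "comm_monoid ?R"
    by (rule comm_monoidI) (simp_all add: simps one mult mult_ac)
  show "(f \<oplus>\<^bsub>?R\<^esub> g) \<otimes>\<^bsub>?R\<^esub> h = f \<otimes>\<^bsub>?R\<^esub> h \<oplus>\<^bsub>?R\<^esub> g \<otimes>\<^bsub>?R\<^esub> h" for f g h
    by (simp add: simps distrib_right)
qed

interpretation poly: vector_space "scale_poly :: 'k \<Rightarrow> ('v, 'k::field) mpoly \<Rightarrow> ('v, 'k) mpoly"
proof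
  fix a b :: 'k and f g :: "('v, 'k) mpoly"
  show "scale_poly a (f + g) = scale_poly a f + scale_poly a g"
    by (simp add: scale_poly_def distrib_left)
  show "scale_poly (a + b) f = scale_poly a f + scale_poly b f"
    by (simp add: scale_poly_def distrib_right single_add)
  show "scale_poly a (scale_poly b f) = scale_poly (a * b) f"
    by (simp add: scale_poly_def mult_single mult.assoc[symmetric])
  show "scale_poly 1 f = f"
    by (simp add: scale_poly_def)
qed

definition linear_forms :: "'v set \<Rightarrow> ('v, 'k::field) mpoly set"
  where "linear_forms A = poly.span (var ` A)"

text \<open>Linearity of a map that only matters on a subspace \<open>V\<close>; the library notion of a linear map
  is for maps defined on the whole type.\<close>

definition linear_between ::
  "('v, 'k::field) mpoly set \<Rightarrow> ('w, 'k) mpoly set \<Rightarrow> (('v, 'k) mpoly \<Rightarrow> ('w, 'k) mpoly) \<Rightarrow> bool"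
  where "linear_between V W h \<longleftrightarrow> h \<in> V \<rightarrow> W \<and>
    (\<forall>f\<in>V. \<forall>g\<in>V. h (f + g) = h f + h g) \<and>
    (\<forall>c. \<forall>f\<in>V. h (scale_poly c f) = scale_poly c (h f))"

definition kernel_on :: "('v, 'k::field) mpoly set \<Rightarrow> (('v, 'k) mpoly \<Rightarrow> ('w, 'k) mpoly) \<Rightarrow> ('v, 'k) mpoly set"
  where "kernel_on V h = {f \<in> V. h f = 0}"

definition is_basis_of :: "('v, 'k::field) mpoly set \<Rightarrow> ('v, 'k) mpoly set \<Rightarrow> bool"
  where "is_basis_of S V \<longleftrightarrow> poly.independent S \<and> poly.span S = V"


section \<open>Regular sequences and the co-letterplace ideal\<close>

definition nonzerodivisor :: "('a, 'b) ring_scheme \<Rightarrow> 'a \<Rightarrow> bool"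
  where "nonzerodivisor S a \<longleftrightarrow>
    a \<in> carrier S \<and> (\<forall>x\<in>carrier S. a \<otimes>\<^bsub>S\<^esub> x = \<zero>\<^bsub>S\<^esub> \<longrightarrow> x = \<zero>\<^bsub>S\<^esub>)"

text \<open>For commutative \<open>S\<close>. No nontriviality condition is imposed on the quotients: for homogeneous
  elements of positive degree in a nonzero graded ring it holds automatically.\<close>

definition regular_sequence :: "('a, 'b) ring_scheme \<Rightarrow> 'a list \<Rightarrow> bool"
  where "regular_sequence S as \<longleftrightarrow> set as \<subseteq> carrier S \<and>
    (\<forall>i<length as. let J = genideal S (set (take i as)) in
       nonzerodivisor (S Quot J) (J +>\<^bsub>S\<^esub> (as ! i)))"

definition coletterplace_ring :: "'p gorder \<Rightarrow> nat \<Rightarrow> ('p \<times> nat, 'k::field) mpoly ring"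
  where "coletterplace_ring P n = poly_ring (carrier (prod_order P (nat_chain n)))"

definition coletterplace_ideal :: "'p gorder \<Rightarrow> nat \<Rightarrow> ('p \<times> nat, 'k::field) mpoly set"
  where "coletterplace_ideal P n =
    genideal (coletterplace_ring P n)
      {\<Prod>p\<in>carrier P. var (p, \<phi> p) | \<phi>. \<phi> \<in> Hom_poset P (nat_chain n)}"

end

theory Submission
  imports Defs
begin

text \<open>
  Let \<open>T\<close> consist of the first few elements of \<open>B\<close>, let \<open>b = x\<^sub>u - x\<^sub>v\<close> be the next one, and write \<open>X\<close> for
  \<open>P \<times> [n]\<close>. Dividing by \<open>T\<close> identifies variables, so the quotient by \<open>L(P,n)\<close> and \<open>T\<close> is again a polynomial
  ring modulo a monomial ideal. A map \<open>\<rho> : X \<rightarrow> X\<close> that picks a representative of each class of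
  identified variables makes this concrete: a polynomial lies in the ideal \<open>L(P,n) + (T)\<close> exactly when,
  after the substitution \<open>x\<^sub>w \<mapsto> x\<^bsub>\<rho> w\<^esub>\<close>, all its monomials are multiples of substituted generators
  (\<open>in_genideal_iff_rename\<close>). Linear independence of \<open>B\<close> says that \<open>a = \<rho> u\<close> and \<open>c = \<rho> v\<close> differ,
  and it remains to see that \<open>x\<^sub>a - x\<^sub>c\<close> is a nonzerodivisor modulo this monomial ideal.

  Suppose that \<open>x\<^sub>a - x\<^sub>c\<close> multiplies \<open>g\<close> into the monomial ideal. On a line of monomials that
  differ only by trading \<open>x\<^sub>a\<close> for \<open>x\<^sub>c\<close>, consider those that occur in \<open>g\<close> and lie outside the ideal.
  Past the two ends of the line there is no such monomial left that could cancel, so the extreme monomials \<open>m\<^sub>1\<close> and \<open>m\<^sub>2\<close> satisfy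
  \<open>x\<^sub>a m\<^sub>1\<close>, \<open>x\<^sub>c m\<^sub>2\<close> in the ideal (\<open>binomial_nonzerodivisor\<close>). The contradiction comes from an
  exchange property: then \<open>m\<^sub>1\<close> or \<open>m\<^sub>2\<close> is in the ideal already (\<open>graph_monomial_exchange\<close>).

  For the exchange property let \<open>\<phi>\<^sub>1\<close> and \<open>\<phi>\<^sub>2\<close> be isotone maps whose substituted monomials divide \<open>x\<^sub>a m\<^sub>1\<close> and
  \<open>x\<^sub>c m\<^sub>2\<close>. For every down-set \<open>D\<close> of \<open>P\<close>, the map \<open>\<chi>\<close> that is \<open>min(\<phi>\<^sub>1, \<phi>\<^sub>2)\<close> on \<open>D\<close> and \<open>max(\<phi>\<^sub>1, \<phi>\<^sub>2)\<close>
  elsewhere is isotone. Along a fiber of \<open>\<psi>\<close> the first coordinates strictly increase while the second ones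
  decrease, whereas isotone maps increase; this forces the graph of \<open>\<chi>\<close> to meet each fiber in
  points of the graph of \<open>\<phi>\<^sub>1\<close> only, or of \<open>\<phi>\<^sub>2\<close> only (\<open>splice_on_chain\<close>). As the classes of \<open>\<rho>\<close> lie inside
  fibers, no exponent of the substituted monomial of \<open>\<chi>\<close> exceeds the larger of those of \<open>\<phi>\<^sub>1\<close> and
  \<open>\<phi>\<^sub>2\<close>. If \<open>m\<^sub>1\<close> and \<open>m\<^sub>2\<close> were both outside the ideal, then by counting \<open>\<phi>\<^sub>1\<close> would have a point in class
  \<open>a\<close> that \<open>\<phi>\<^sub>2\<close> lacks, and \<open>\<phi>\<^sub>2\<close> a point in class \<open>c\<close> that \<open>\<phi>\<^sub>1\<close> lacks; a suitable \<open>D\<close> makes \<open>\<chi>\<close> avoid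
  both (\<open>exchange_isotone\<close>). So the substituted monomial of \<open>\<chi>\<close> divides \<open>m\<^sub>1\<close> if \<open>\<chi>\<close> follows \<open>\<phi>\<^sub>1\<close> on the fiber containing
  both classes, and \<open>m\<^sub>2\<close> if it follows \<open>\<phi>\<^sub>2\<close> there, a contradiction.
\<close>

section \<open>Push-forward of finitely supported functions\<close>

lemma poly_mapping_sum_single:
  "f = (\<Sum>a\<in>Poly_Mapping.keys f. Poly_Mapping.single a (Poly_Mapping.lookup f a))"
  by (rule poly_mapping_eqI) (simp add: lookup_sum lookup_single when_def in_keys_iff)

lemma poly_mapping_additive_induct [case_names single add]:
  assumes single: "\<And>a c. Q (Poly_Mapping.single a c)"
    and add: "\<And>f g. Q f \<Longrightarrow> Q g \<Longrightarrow> Q (f + g)"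
  shows "Q (f :: 'a \<Rightarrow>\<^sub>0 'b::comm_monoid_add)"
proof -
  have "Q (\<Sum>a\<in>A. Poly_Mapping.single a (c a))" if "finite A" for A and c :: "'a \<Rightarrow> 'b"
    using that
  proof (induction A rule: finite_induct)
    case empty
    show ?case using single[of undefined 0] by simp
  next
    case (insert a A)
    then show ?case by (simp add: single add)
  qed
  then show ?thesis
    by (subst poly_mapping_sum_single) simp
qed

text \<open>On monomials this substitutes variables along \<open>h\<close>, adding up the exponents of variables that are
  identified; applied once more to the monomials of a polynomial, it substitutes variables in the
  polynomial.\<close>

definition push :: "('a \<Rightarrow> 'b) \<Rightarrow> ('a \<Rightarrow>\<^sub>0 'c::comm_monoid_add) \<Rightarrow> ('b \<Rightarrow>\<^sub>0 'c)"
  where "push h f = (\<Sum>a\<in>Poly_Mapping.keys f. Poly_Mapping.single (h a) (Poly_Mapping.lookup f a))"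

lemma push_eq_sum:
  assumes "finite A" "Poly_Mapping.keys f \<subseteq> A"
  shows "push h f = (\<Sum>a\<in>A. Poly_Mapping.single (h a) (Poly_Mapping.lookup f a))"
  unfolding push_def using assms by (intro sum.mono_neutral_left) (auto simp: in_keys_iff)

lemma push_single [simp]: "push h (Poly_Mapping.single a c) = Poly_Mapping.single (h a) c"
  by (simp add: push_def)

lemma push_zero [simp]: "push h 0 = 0"
  by (simp add: push_def)

lemma push_add: "push h (f + g) = push h f + push h g"
proof -
  let ?A = "Poly_Mapping.keys f \<union> Poly_Mapping.keys g"
  have "push h k = (\<Sum>a\<in>?A. Poly_Mapping.single (h a) (Poly_Mapping.lookup k a))"
    if "k \<in> {f, g, f + g}" for k
    using that Poly_Mapping.keys_add[of f g] by (intro push_eq_sum) auto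
  then show ?thesis
    by (simp add: lookup_add single_add sum.distrib)
qed

lemma push_diff:
  fixes f g :: "'a \<Rightarrow>\<^sub>0 'c::ab_group_add"
  shows "push h (f - g) = push h f - push h g"
  by (metis add_diff_cancel diff_add_cancel push_add)

lemma push_sum: "push h (\<Sum>i\<in>I. f i) = (\<Sum>i\<in>I. push h (f i))"
  by (induction I rule: infinite_finite_induct) (simp_all add: push_add)

lemma push_mult:
  fixes f g :: "'a::monoid_add \<Rightarrow>\<^sub>0 'c::semiring_0"
  assumes "\<And>a b. h (a + b) = h a + h b"
  shows "push h (f * g) = push h f * push h g"
proof (induction f rule: poly_mapping_additive_induct)
  case (single a c)
  show ?case
  proof (induction g rule: poly_mapping_additive_induct)
    case (single b d)
    show ?case by (simp add: mult_single assms)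
  qed (simp add: push_add distrib_left)
qed (simp add: push_add distrib_right)

lemma keys_push: "Poly_Mapping.keys (push h f) \<subseteq> h ` Poly_Mapping.keys f"
  unfolding push_def by (rule order_trans[OF keys_sum]) auto

abbreviation rename :: "('v \<Rightarrow> 'w) \<Rightarrow> ('v, 'k::field) mpoly \<Rightarrow> ('w, 'k) mpoly"
  where "rename \<rho> \<equiv> push (push \<rho>)"

lemma rename_var [simp]: "rename \<rho> (var x) = var (\<rho> x)"
  by (simp add: var_def)

section \<open>Binomials modulo a monomial ideal\<close>

lemma lookup_single_mult:
  fixes s :: "'a::cancel_comm_monoid_add"
  shows "Poly_Mapping.lookup (Poly_Mapping.single s (1::'k::field) * g) (s + m) = Poly_Mapping.lookup g m"
  by (induction g rule: poly_mapping_additive_induct)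
     (simp_all add: mult_single lookup_single distrib_left lookup_add)

text \<open>The coefficient of \<open>m x\<^sub>a\<close> in \<open>(x\<^sub>a - x\<^sub>c) g\<close> is that of \<open>m\<close> in \<open>g\<close>, unless it is cancelled by the
  neighbour \<open>m' = m x\<^sub>a / x\<^sub>c\<close>. If \<open>m'\<close> occurs in \<open>g\<close>, it is in \<open>E\<close> by hypothesis, and then so is its
  multiple \<open>m x\<^sub>a\<close>.\<close>

lemma extreme_monomial:
  fixes g :: "('v, 'k::field) mpoly"
  assumes up: "\<And>m m'. m \<in> E \<Longrightarrow> m + m' \<in> E"
    and prod: "Poly_Mapping.keys ((var a - var c) * g) \<subseteq> E"
    and m: "m \<in> Poly_Mapping.keys g"
    and ext: "\<And>m'. \<lbrakk>m' \<in> Poly_Mapping.keys g;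
      m' + Poly_Mapping.single c 1 = m + Poly_Mapping.single a 1\<rbrakk> \<Longrightarrow> m' \<in> E"
  shows "m + Poly_Mapping.single a 1 \<in> E"
proof (cases "m + Poly_Mapping.single a 1 \<in> Poly_Mapping.keys (var c * g)")
  case True
  then obtain m' where "m' \<in> Poly_Mapping.keys g" "m + Poly_Mapping.single a 1 = Poly_Mapping.single c 1 + m'"
    using subsetD[OF keys_mult True] by (auto simp: var_def)
  then show ?thesis
    using ext[of m'] up[of m' "Poly_Mapping.single c 1"] by (simp add: add.commute)
next
  case False
  have "Poly_Mapping.lookup ((var a - var c) * g) (m + Poly_Mapping.single a 1) =
      Poly_Mapping.lookup g m"
    using False lookup_single_mult[of "Poly_Mapping.single a 1" g m]
    by (simp add: left_diff_distrib lookup_minus in_keys_iff add.commute var_def)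
  then have "m + Poly_Mapping.single a 1 \<in> Poly_Mapping.keys ((var a - var c) * g)"
    using m by (simp add: in_keys_iff)
  then show ?thesis using prod by blast
qed

text \<open>The set \<open>E\<close> plays the role of the monomials of a monomial ideal. The proof looks at the
  monomials of \<open>g\<close> outside \<open>E\<close> on one line \<open>m\<^sub>0 (x\<^sub>a / x\<^sub>c)\<^sup>t\<close> and applies the exchange property to the two
  extreme ones.\<close>

lemma binomial_nonzerodivisor:
  fixes g :: "('v, 'k::field) mpoly"
  assumes up: "\<And>m m'. m \<in> E \<Longrightarrow> m + m' \<in> E"
    and "a \<noteq> c"
    and exch: "\<And>m1 m2. \<lbrakk>m1 + Poly_Mapping.single a 1 \<in> E; m2 + Poly_Mapping.single c 1 \<in> E;
      \<And>w. w \<noteq> a \<Longrightarrow> w \<noteq> c \<Longrightarrow> Poly_Mapping.lookup m1 w = Poly_Mapping.lookup m2 w;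
      Poly_Mapping.lookup m2 a \<le> Poly_Mapping.lookup m1 a;
      Poly_Mapping.lookup m1 c \<le> Poly_Mapping.lookup m2 c\<rbrakk> \<Longrightarrow> m1 \<in> E \<or> m2 \<in> E"
    and prod: "Poly_Mapping.keys ((var a - var c) * g) \<subseteq> E"
  shows "Poly_Mapping.keys g \<subseteq> E"
proof (rule ccontr)
  assume "\<not> Poly_Mapping.keys g \<subseteq> E"
  then obtain m0 where m0: "m0 \<in> Poly_Mapping.keys g" "m0 \<notin> E" by blast
  let ?l = Poly_Mapping.lookup
  define Z where "Z = {m \<in> Poly_Mapping.keys g. m \<notin> E \<and>
    (\<forall>w. w \<noteq> a \<longrightarrow> w \<noteq> c \<longrightarrow> ?l m w = ?l m0 w) \<and> ?l m a + ?l m c = ?l m0 a + ?l m0 c}"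
  have Z: "finite Z" "Z \<noteq> {}"
    unfolding Z_def using m0 by auto
  have "\<exists>m\<in>Z. \<forall>m'\<in>Z. ?l m' x \<le> ?l m x" for x
  proof -
    have "Max ((\<lambda>m. ?l m x) ` Z) \<in> (\<lambda>m. ?l m x) ` Z"
      using Z by (intro Max_in) auto
    then obtain m where "m \<in> Z" "?l m x = Max ((\<lambda>m. ?l m x) ` Z)" by auto
    then show ?thesis using Z(1) by (intro bexI[of _ m]) auto
  qed
  then obtain m1 m2 where m1: "m1 \<in> Z" "\<And>m. m \<in> Z \<Longrightarrow> ?l m a \<le> ?l m1 a"
    and m2: "m2 \<in> Z" "\<And>m. m \<in> Z \<Longrightarrow> ?l m c \<le> ?l m2 c"
    by metis
  \<comment> \<open>One step from \<open>m\<close> along the line leads to \<open>m'\<close>. The pair \<open>(p, q)\<close> is \<open>(a, c)\<close> or \<open>(c, a)\<close>, so that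
  both directions are covered.\<close>
  have shift: "m' \<in> Z \<and> ?l m' p = ?l m p + 1"
    if "m' \<in> Poly_Mapping.keys g" "m' \<notin> E" "m \<in> Z" "{p, q} = {a, c}"
      "m' + Poly_Mapping.single q 1 = m + Poly_Mapping.single p 1" for m m' p q
  proof -
    have *: "?l m' w + (1 when q = w) = ?l m w + (1 when p = w)" for w
      using arg_cong[OF that(5), of "\<lambda>k. ?l k w"] by (simp add: lookup_add lookup_single)
    have "p \<noteq> q" using that(4) \<open>a \<noteq> c\<close> by auto
    moreover have "?l m' w = ?l m w" if "w \<noteq> p" "w \<noteq> q" for w
      using *[of w] that by simp
    moreover have "?l m' p = ?l m p + 1" "?l m' q + 1 = ?l m q"
      using *[of p] *[of q] \<open>p \<noteq> q\<close> by (auto simp: when_def)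
    moreover have "p = a \<and> q = c \<or> p = c \<and> q = a"
      using that(4) by (simp add: doubleton_eq_iff)
    ultimately show ?thesis
      using that(1-3) unfolding Z_def by (elim disjE conjE) simp_all
  qed
  have "m1 + Poly_Mapping.single a 1 \<in> E"
  proof (rule extreme_monomial[OF up prod])
    show "m1 \<in> Poly_Mapping.keys g" using m1 by (simp add: Z_def)
    show "m' \<in> E" if "m' \<in> Poly_Mapping.keys g"
      "m' + Poly_Mapping.single c 1 = m1 + Poly_Mapping.single a 1" for m'
      using shift[OF that(1) _ m1(1) _ that(2)] m1(2)[of m'] by (cases "m' \<in> E") simp_all
  qed
  moreover have "m2 + Poly_Mapping.single c 1 \<in> E"
  proof (rule extreme_monomial[OF up])
    have "(var c - var a) * g = - ((var a - var c) * g)"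
      by (simp add: algebra_simps)
    then show "Poly_Mapping.keys ((var c - var a) * g) \<subseteq> E"
      using prod by simp
    show "m2 \<in> Poly_Mapping.keys g" using m2 by (simp add: Z_def)
    show "m' \<in> E" if "m' \<in> Poly_Mapping.keys g"
      "m' + Poly_Mapping.single a 1 = m2 + Poly_Mapping.single c 1" for m'
      using shift[OF that(1) _ m2(1) _ that(2)] m2(2)[of m'] by (cases "m' \<in> E") (simp_all add: insert_commute)
  qed
  moreover have "?l m2 a \<le> ?l m1 a" using m1 m2 by blast
  moreover have "?l m1 c \<le> ?l m2 c" using m1 m2 by blast
  ultimately have "m1 \<in> E \<or> m2 \<in> E"
    using m1(1) m2(1) by (intro exch) (simp_all add: Z_def)
  then show False
    using m1(1) m2(1) by (simp add: Z_def)
qed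

section \<open>Splicing two isotone maps\<close>

text \<open>Left strictness makes the first coordinates of a chain in \<open>P \<times> [n]\<^sup>o\<^sup>p\<close> pairwise distinct; in the
  order of \<open>P\<close> the second coordinates then decrease.\<close>

lemma left_strict_chain_cases:
  assumes "partial_order P" "left_strict_chain P (inv_gorder (nat_chain n)) F"
    and "(p, i) \<in> F" "(q, j) \<in> F" "(p, i) \<noteq> (q, j)"
  shows "p \<in> carrier P \<and> q \<in> carrier P \<and> p \<noteq> q \<and> (p \<sqsubseteq>\<^bsub>P\<^esub> q \<and> j \<le> i \<or> q \<sqsubseteq>\<^bsub>P\<^esub> p \<and> i \<le> j)"
proof -
  interpret partial_order P by fact
  have "p \<in> carrier P" "q \<in> carrier P"
    using assms(2-4) by (auto simp: left_strict_chain_def is_chain_def prod_order_def)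
  moreover
  have chain: "\<forall>x\<in>F. \<forall>y\<in>F. x \<sqsubseteq>\<^bsub>prod_order P (inv_gorder (nat_chain n))\<^esub> y \<or>
      y \<sqsubseteq>\<^bsub>prod_order P (inv_gorder (nat_chain n))\<^esub> x"
    using assms(2) by (simp add: left_strict_chain_def is_chain_def)
  have "p \<sqsubseteq>\<^bsub>P\<^esub> q \<and> j \<le> i \<or> q \<sqsubseteq>\<^bsub>P\<^esub> p \<and> i \<le> j"
    using bspec[OF bspec[OF chain assms(3)] assms(4)] by (auto simp: prod_order_def nat_chain_def)
  moreover have "p \<noteq> q"
  proof
    assume "p = q"
    have strict: "\<not> (a, b) \<sqsubset>\<^bsub>prod_order P (inv_gorder (nat_chain n))\<^esub> (a, b')"
      if "(a, b) \<in> F" "(a, b') \<in> F" for a b b'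
    proof -
      have "\<forall>x\<in>F. \<forall>y\<in>F. x \<sqsubset>\<^bsub>prod_order P (inv_gorder (nat_chain n))\<^esub> y \<longrightarrow> fst x \<sqsubset>\<^bsub>P\<^esub> fst y"
        using assms(2) unfolding left_strict_chain_def by (simp add: case_prod_beta)
      from bspec[OF bspec[OF this that(1)] that(2)] show ?thesis
        by (auto simp: lless_def eq_is_equal)
    qed
    show False
      using strict[of p i j] strict[of p j i] bspec[OF bspec[OF chain assms(3)] assms(4)] assms(3-5) \<open>p = q\<close>
      by (auto simp: lless_def prod_order_def)
  qed
  ultimately show ?thesis by blast
qed

definition splice :: "'p set \<Rightarrow> ('p \<Rightarrow> nat) \<Rightarrow> ('p \<Rightarrow> nat) \<Rightarrow> 'p \<Rightarrow> nat"
  where "splice D \<phi> \<phi>' p = (if p \<in> D then min (\<phi> p) (\<phi>' p) else max (\<phi> p) (\<phi>' p))"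

lemma Hom_nat_chain_mono:
  assumes "\<phi> \<in> Hom_poset P (nat_chain n)" "p \<in> carrier P" "q \<in> carrier P" "p \<sqsubseteq>\<^bsub>P\<^esub> q"
  shows "\<phi> p \<le> \<phi> q"
  using assms by (auto simp: Hom_poset_def isotone_def nat_chain_def)

lemma splice_Hom:
  assumes \<phi>: "\<phi> \<in> Hom_poset P (nat_chain n)" "\<phi>' \<in> Hom_poset P (nat_chain n)"
    and D: "\<And>p q. \<lbrakk>p \<in> carrier P; q \<in> carrier P; q \<in> D; p \<sqsubseteq>\<^bsub>P\<^esub> q\<rbrakk> \<Longrightarrow> p \<in> D"
  shows "splice D \<phi> \<phi>' \<in> Hom_poset P (nat_chain n)"
proof -
  have "splice D \<phi> \<phi>' \<in> carrier P \<rightarrow>\<^sub>E carrier (nat_chain n)"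
    using \<phi> by (auto simp: Hom_poset_def splice_def PiE_iff min_def max_def extensional_def)
  moreover have "splice D \<phi> \<phi>' p \<le> splice D \<phi> \<phi>' q"
    if "p \<in> carrier P" "q \<in> carrier P" "p \<sqsubseteq>\<^bsub>P\<^esub> q" for p q
    using D[OF that(1,2) _ that(3)] Hom_nat_chain_mono[OF \<phi>(1) that]
      Hom_nat_chain_mono[OF \<phi>(2) that]
    by (auto simp: splice_def min_def max_def)
  ultimately show ?thesis
    using \<phi>(1) by (auto simp: Hom_poset_def isotone_def nat_chain_def)
qed

text \<open>Suppose that \<open>\<chi>\<close>, the spliced map, has points over \<open>p\<close> and \<open>q\<close> in the chain with
  \<open>\<chi> p = \<phi>' p \<noteq> \<phi> p\<close> and \<open>\<chi> q = \<phi> q \<noteq> \<phi>' q\<close>. If \<open>p < q\<close>, then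
  \<open>\<phi> p \<le> \<phi> q \<le> \<phi>' p \<le> \<phi>' q\<close>, the middle inequality by the chain condition. Hence \<open>\<chi>\<close> is the maximum at
  \<open>p\<close> and the minimum at \<open>q\<close>, so \<open>p \<notin> D\<close> and \<open>q \<in> D\<close>, which is impossible for a down-set. The case
  \<open>q < p\<close> is the same with \<open>p\<close> and \<open>q\<close>, and \<open>\<phi>\<close> and \<open>\<phi>'\<close>, interchanged.\<close>

lemma splice_on_chain:
  assumes P: "partial_order P" and F: "left_strict_chain P (inv_gorder (nat_chain n)) F"
    and \<phi>: "\<phi> \<in> Hom_poset P (nat_chain n)" "\<phi>' \<in> Hom_poset P (nat_chain n)"
    and D: "\<And>p q. \<lbrakk>p \<in> carrier P; q \<in> carrier P; q \<in> D; p \<sqsubseteq>\<^bsub>P\<^esub> q\<rbrakk> \<Longrightarrow> p \<in> D"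
  shows "(\<forall>p. (p, splice D \<phi> \<phi>' p) \<in> F \<longrightarrow> splice D \<phi> \<phi>' p = \<phi> p) \<or>
    (\<forall>p. (p, splice D \<phi> \<phi>' p) \<in> F \<longrightarrow> splice D \<phi> \<phi>' p = \<phi>' p)"
proof (rule ccontr)
  assume "\<not> ?thesis"
  then obtain p q where p: "(p, splice D \<phi> \<phi>' p) \<in> F" "splice D \<phi> \<phi>' p \<noteq> \<phi> p"
    and q: "(q, splice D \<phi> \<phi>' q) \<in> F" "splice D \<phi> \<phi>' q \<noteq> \<phi>' q"
    by blast
  then have s: "splice D \<phi> \<phi>' p = \<phi>' p" "splice D \<phi> \<phi>' q = \<phi> q" "p \<noteq> q"
    by (auto simp: splice_def min_def max_def split: if_splits)
  note c = left_strict_chain_cases[OF P F p(1) q(1)]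
  then have pq: "p \<in> carrier P" "q \<in> carrier P"
    using s(3) by auto
  from c s consider "p \<sqsubseteq>\<^bsub>P\<^esub> q" "\<phi> q \<le> \<phi>' p" | "q \<sqsubseteq>\<^bsub>P\<^esub> p" "\<phi>' p \<le> \<phi> q"
    by auto
  then show False
  proof cases
    case 1
    then show False
      using D[OF pq] Hom_nat_chain_mono[OF \<phi>(1) pq] Hom_nat_chain_mono[OF \<phi>(2) pq] p(2) q(2)
      by (auto simp: splice_def min_def max_def split: if_splits)
  next
    case 2
    then show False
      using D[OF pq(2,1)] Hom_nat_chain_mono[OF \<phi>(1) pq(2,1)] Hom_nat_chain_mono[OF \<phi>(2) pq(2,1)] p(2) q(2)
      by (auto simp: splice_def min_def max_def split: if_splits)
  qed
qed

text \<open>If \<open>u < v\<close>, the chain condition gives \<open>\<phi>' u \<le> \<phi>' v \<le> \<phi> u \<le> \<phi> v\<close>, so the minimum at \<open>u\<close> and the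
  maximum at \<open>v\<close> avoid both points. A down-set that contains \<open>u\<close> but not \<open>v\<close> therefore serves, for instance the
  principal one of \<open>u\<close>; if \<open>v < u\<close>, the principal down-set of \<open>v\<close>.\<close>

lemma exchange_isotone:
  assumes P: "partial_order P" and F: "left_strict_chain P (inv_gorder (nat_chain n)) F"
    and \<phi>: "\<phi> \<in> Hom_poset P (nat_chain n)" "\<phi>' \<in> Hom_poset P (nat_chain n)"
    and u: "(u, \<phi> u) \<in> F" "\<phi> u \<noteq> \<phi>' u" and v: "(v, \<phi>' v) \<in> F" "\<phi> v \<noteq> \<phi>' v"
    and uv: "(u, \<phi> u) \<noteq> (v, \<phi>' v)"
  obtains \<chi> where "\<chi> \<in> Hom_poset P (nat_chain n)" "\<chi> u \<noteq> \<phi> u" "\<chi> v \<noteq> \<phi>' v"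
    "\<And>G. left_strict_chain P (inv_gorder (nat_chain n)) G \<Longrightarrow>
      (\<forall>p. (p, \<chi> p) \<in> G \<longrightarrow> \<chi> p = \<phi> p) \<or> (\<forall>p. (p, \<chi> p) \<in> G \<longrightarrow> \<chi> p = \<phi>' p)"
proof -
  interpret partial_order P by fact
  note c = left_strict_chain_cases[OF P F u(1) v(1) uv]
  then have uvP: "u \<in> carrier P" "v \<in> carrier P" "u \<noteq> v" by auto
  define w where "w = (if u \<sqsubseteq>\<^bsub>P\<^esub> v then u else v)"
  define D where "D = {p. p \<sqsubseteq>\<^bsub>P\<^esub> w}"
  have w: "w \<in> carrier P" using uvP by (simp add: w_def)
  have D: "p \<in> D" if "p \<in> carrier P" "q \<in> carrier P" "q \<in> D" "p \<sqsubseteq>\<^bsub>P\<^esub> q" for p q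
    using that w le_trans unfolding D_def by blast
  have "splice D \<phi> \<phi>' u \<noteq> \<phi> u \<and> splice D \<phi> \<phi>' v \<noteq> \<phi>' v"
  proof (cases "u \<sqsubseteq>\<^bsub>P\<^esub> v")
    case True
    then have "\<not> v \<sqsubseteq>\<^bsub>P\<^esub> u" using uvP le_antisym by blast
    moreover have "\<phi> u \<le> \<phi> v" "\<phi>' u \<le> \<phi>' v"
      using True uvP \<phi> by (auto intro: Hom_nat_chain_mono)
    ultimately show ?thesis
      using True c u(2) v(2) uvP by (auto simp: splice_def D_def w_def min_def max_def)
  next
    case False
    moreover have "\<phi> v \<le> \<phi> u" "\<phi>' v \<le> \<phi>' u"
      using False c \<phi> by (auto intro: Hom_nat_chain_mono)
    ultimately show ?thesis
      using c u(2) v(2) uvP by (auto simp: splice_def D_def w_def min_def max_def)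
  qed
  then show thesis
    by (intro that[of "splice D \<phi> \<phi>'"] splice_Hom[OF \<phi>] splice_on_chain[OF P _ \<phi>]) (blast intro: D)+
qed

section \<open>Regular sequences modulo an ideal\<close>

lemma (in ring) Quot_zero_iff:
  assumes "ideal J R" "x \<in> carrier R"
  shows "J +> x = \<zero>\<^bsub>R Quot J\<^esub> \<longleftrightarrow> x \<in> J"
proof -
  interpret J: ideal J R by fact
  show ?thesis
    using assms(2) J.a_rcos_self[OF assms(2)] J.a_rcos_const[of x] by (auto simp: FactRing_def)
qed

lemma (in ring) carrier_Quot: "carrier (R Quot J) = (\<lambda>x. J +> x) ` carrier R"
  by (auto simp: FactRing_def A_RCOSETS_def')

lemma (in ring) nonzerodivisor_Quot_iff:
  assumes "ideal J R" "a \<in> carrier R"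
  shows "nonzerodivisor (R Quot J) (J +> a) \<longleftrightarrow> (\<forall>x\<in>carrier R. a \<otimes> x \<in> J \<longrightarrow> x \<in> J)"
proof -
  interpret J: ring_hom_ring R "R Quot J" "(+>) J"
    by (rule ideal.rcos_ring_hom_ring[OF assms(1)])
  have "(J +> a) \<otimes>\<^bsub>R Quot J\<^esub> (J +> x) = \<zero>\<^bsub>R Quot J\<^esub> \<longleftrightarrow> a \<otimes> x \<in> J" if "x \<in> carrier R" for x
    using that assms Quot_zero_iff[OF assms(1), of "a \<otimes> x"] by simp
  then show ?thesis
    unfolding nonzerodivisor_def carrier_Quot using assms Quot_zero_iff[OF assms(1)] by auto
qed

text \<open>Ideals of \<open>R / L\<close> correspond to ideals of \<open>R\<close> above \<open>L\<close>: the image of the ideal generated by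
  \<open>L \<union> T\<close> contains the generators of the ideal in the quotient, and the preimage of the latter
  contains \<open>L \<union> T\<close>.\<close>

lemma (in ring) rcoset_in_genideal_Quot_iff:
  assumes L: "ideal L R" and T: "T \<subseteq> carrier R" and x: "x \<in> carrier R"
  shows "L +> x \<in> genideal (R Quot L) ((\<lambda>a. L +> a) ` T) \<longleftrightarrow> x \<in> Idl (L \<union> T)"
proof -
  interpret L: ideal L R by fact
  interpret q: ring_hom_ring R "R Quot L" "(+>) L" by (rule L.rcos_ring_hom_ring)
  have LT: "L \<union> T \<subseteq> carrier R" using T L.a_subset by auto
  then interpret K: ideal "Idl (L \<union> T)" R by (rule genideal_ideal)
  have K: "L \<union> T \<subseteq> Idl (L \<union> T)" by (rule genideal_self[OF LT])
  let ?J = "genideal (R Quot L) ((\<lambda>a. L +> a) ` T)"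
  have J: "ideal ?J (R Quot L)" and TJ: "(\<lambda>a. L +> a) ` T \<subseteq> ?J"
    using T by (auto intro!: q.S.genideal_ideal subsetD[OF q.S.genideal_self])
  show ?thesis
  proof
    assume "L +> x \<in> ?J"
    moreover have "?J \<subseteq> (\<lambda>a. L +> a) ` (Idl (L \<union> T))"
      using K by (intro q.S.genideal_minimal ring_ideal_imp_quot_ideal L K.is_ideal) auto
    ultimately obtain y where y: "y \<in> Idl (L \<union> T)" "L +> x = L +> y" by auto
    have "x \<in> L +> y" using L.a_rcos_self[OF x] y(2) by simp
    then obtain l where "l \<in> L" "x = l \<oplus> y" by (auto simp: a_r_coset_def')
    then show "x \<in> Idl (L \<union> T)" using K y(1) by blast
  next
    assume "x \<in> Idl (L \<union> T)"
    moreover have "Idl (L \<union> T) \<subseteq> {r \<in> carrier R. L +> r \<in> ?J}"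
    proof (rule genideal_minimal)
      show "ideal {r \<in> carrier R. L +> r \<in> ?J} R"
        by (rule q.ideal_vimage[OF J])
      have "L +> l \<in> ?J" if "l \<in> L" for l
      proof -
        have "L +> l = \<zero>\<^bsub>R Quot L\<^esub>"
          using that L.a_subset by (subst Quot_zero_iff[OF L]) auto
        then show ?thesis
          using additive_subgroup.zero_closed[OF ideal.axioms(1)[OF J]] by simp
      qed
      then show "L \<union> T \<subseteq> {r \<in> carrier R. L +> r \<in> ?J}"
        using LT TJ by auto
    qed
    ultimately show "L +> x \<in> ?J" by blast
  qed
qed

text \<open>This removes both layers of quotients: regularity on \<open>R / L\<close> becomes a statement about
  membership in ideals of \<open>R\<close>.\<close>

lemma (in ring) regular_sequence_QuotI:
  assumes L: "ideal L R" and bs: "set bs \<subseteq> carrier R"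
    and nzd: "\<And>i x. \<lbrakk>i < length bs; x \<in> carrier R; bs ! i \<otimes> x \<in> Idl (L \<union> set (take i bs))\<rbrakk>
      \<Longrightarrow> x \<in> Idl (L \<union> set (take i bs))"
  shows "regular_sequence (R Quot L) (map (\<lambda>b. L +> b) bs)"
proof -
  interpret q: ring_hom_ring R "R Quot L" "(+>) L" by (rule ideal.rcos_ring_hom_ring[OF L])
  have "nonzerodivisor ((R Quot L) Quot J) (J +>\<^bsub>R Quot L\<^esub> map ((+>) L) bs ! i)"
    if i: "i < length bs" and J: "J = genideal (R Quot L) (set (take i (map ((+>) L) bs)))" for i J
  proof -
    have T: "set (take i bs) \<subseteq> carrier R" "bs ! i \<in> carrier R"
      using bs i set_take_subset[of i bs] by auto
    have J': "J = genideal (R Quot L) ((+>) L ` set (take i bs))"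
      unfolding J by (simp add: take_map)
    then have J_ideal: "ideal J (R Quot L)"
      using T by (auto intro!: q.S.genideal_ideal)
    have mem: "L +> x \<in> J \<longleftrightarrow> x \<in> Idl (L \<union> set (take i bs))" if "x \<in> carrier R" for x
      unfolding J' by (rule rcoset_in_genideal_Quot_iff[OF L T(1) that])
    show ?thesis
      using i T nzd[OF i]
      by (subst q.S.nonzerodivisor_Quot_iff[OF J_ideal])
        (auto simp: carrier_Quot mem simp flip: q.hom_mult)
  qed
  then show ?thesis
    unfolding regular_sequence_def Let_def using bs by auto
qed

section \<open>Identifying variables\<close>

lemma poly_ring_simps [simp]:
  "f \<oplus>\<^bsub>poly_ring A\<^esub> g = f + g" "f \<otimes>\<^bsub>poly_ring A\<^esub> g = f * g"
  "\<zero>\<^bsub>poly_ring A\<^esub> = 0" "\<one>\<^bsub>poly_ring A\<^esub> = 1"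
  by (simp_all add: poly_ring_def)

lemma poly_ring_carrier_iff:
  "f \<in> carrier (poly_ring A) \<longleftrightarrow> (\<forall>m\<in>Poly_Mapping.keys f. Poly_Mapping.keys m \<subseteq> A)"
  by (simp add: poly_ring_def)

lemma single_in_poly_ring [intro]:
  "Poly_Mapping.keys m \<subseteq> A \<Longrightarrow> Poly_Mapping.single m c \<in> carrier (poly_ring A)"
  by (simp add: poly_ring_carrier_iff)

lemma var_diff_in_poly_ring:
  "x \<in> A \<Longrightarrow> y \<in> A \<Longrightarrow> var x - var y \<in> carrier (poly_ring A)"
  using keys_diff[of "var x" "var y"] by (fastforce simp: poly_ring_carrier_iff var_def)

lemma poly_ring_ideal:
  fixes K :: "('v, 'k::field) mpoly set"
  assumes "ideal K (poly_ring A)"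
  shows "0 \<in> K"
    and "f \<in> K \<Longrightarrow> g \<in> K \<Longrightarrow> f + g \<in> K"
    and "f \<in> K \<Longrightarrow> h \<in> carrier (poly_ring A) \<Longrightarrow> h * f \<in> K"
    and "poly.subspace K"
    and "f \<in> K \<Longrightarrow> g \<in> K \<Longrightarrow> f - g \<in> K"
    and "(\<And>i. i \<in> I \<Longrightarrow> F i \<in> K) \<Longrightarrow> sum F I \<in> K"
proof -
  interpret K: ideal K "poly_ring A" by fact
  show zero: "0 \<in> K" using additive_subgroup.zero_closed[OF K.is_additive_subgroup] by simp
  show add: "f + g \<in> K" if "f \<in> K" "g \<in> K" for f g
    using additive_subgroup.a_closed[OF K.is_additive_subgroup that] by simp
  show mult: "h * f \<in> K" if "f \<in> K" "h \<in> carrier (poly_ring A)" for f h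
    using K.I_l_closed[OF that] by simp
  have "scale_poly c f \<in> K" if "f \<in> K" for c f
    unfolding scale_poly_def using that by (intro mult) auto
  then show sub: "poly.subspace K"
    using zero add by (auto simp: poly.subspace_def)
  show "f - g \<in> K" if "f \<in> K" "g \<in> K" for f g
    using poly.subspace_diff[OF sub that] .
  show "sum F I \<in> K" if "\<And>i. i \<in> I \<Longrightarrow> F i \<in> K"
    using poly.subspace_sum[OF sub that] .
qed

lemma var_eq_iff [simp]: "(var x :: ('v, 'k::field) mpoly) = var y \<longleftrightarrow> x = y"
proof
  assume "(var x :: ('v, 'k) mpoly) = var y"
  then have "Poly_Mapping.keys (var x :: ('v, 'k) mpoly) = Poly_Mapping.keys (var y :: ('v, 'k) mpoly)"
    by simp
  then have "Poly_Mapping.keys (Poly_Mapping.single x (1::nat)) = Poly_Mapping.keys (Poly_Mapping.single y (1::nat))"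
    by (simp add: var_def)
  then show "x = y" by simp
qed simp

text \<open>Every difference in \<open>T\<close> is an edge between two variables, and \<open>\<rho>\<close> contracts the connected components
  of the resulting graph. Membership in the span of \<open>T\<close> is what later turns linear independence into the
  statement that a further difference joins two distinct components; compatibility with \<open>\<psi>\<close> keeps
  each component inside one fiber. Edges are added one at a time, redirecting the component of \<open>u\<close> to the
  representative of \<open>v\<close>.\<close>

lemma identification_exists:
  fixes T :: "('v, 'k::field) mpoly set"
  assumes "finite T"
    and "\<forall>b\<in>T. \<exists>x\<in>A. \<exists>y\<in>A. \<psi> x = \<psi> y \<and> b = var x - var y"
  shows "\<exists>\<rho>. (\<forall>x\<in>A. \<rho> x \<in> A \<and> \<psi> (\<rho> x) = \<psi> x \<and> var x - var (\<rho> x) \<in> poly.span T) \<and>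
    (\<forall>b\<in>T. rename \<rho> b = 0)"
  using assms
proof (induction T rule: finite_induct)
  case empty
  show ?case by (rule exI[of _ id]) simp
next
  case (insert b T)
  then obtain \<rho> where \<rho>: "\<And>x. x \<in> A \<Longrightarrow> \<rho> x \<in> A \<and> \<psi> (\<rho> x) = \<psi> x \<and> var x - var (\<rho> x) \<in> poly.span T"
    and T: "\<And>b. b \<in> T \<Longrightarrow> rename \<rho> b = 0" by auto
  obtain u v where uv: "u \<in> A" "v \<in> A" "\<psi> u = \<psi> v" "b = var u - var v"
    using insert.prems by auto
  define \<rho>' where "\<rho>' = (\<lambda>x. if \<rho> x = \<rho> u then \<rho> v else \<rho> x)"
  have span: "f \<in> poly.span (insert b T)" if "f \<in> poly.span T" for f
    using that poly.span_mono[of T "insert b T"] by auto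
  have "var x - var (\<rho>' x) \<in> poly.span (insert b T)" if "x \<in> A" for x
  proof (cases "\<rho> x = \<rho> u")
    case True
    have "b \<in> poly.span (insert b T)" by (simp add: poly.span_base)
    moreover have "var y - var (\<rho> y) \<in> poly.span (insert b T)" if "y \<in> A" for y
      using \<rho>[OF that] span by blast
    ultimately have "(var x - var (\<rho> x)) - (var u - var (\<rho> u)) + b + (var v - var (\<rho> v))
        \<in> poly.span (insert b T)"
      using that uv(1,2) by (auto simp only: intro!: poly.span_add[OF poly.span_add[OF poly.span_diff]])
    then show ?thesis using True by (simp add: \<rho>'_def uv(4))
  next
    case False
    then show ?thesis using \<rho>[OF that] span by (simp add: \<rho>'_def)
  qed
  moreover have "rename \<rho>' c = 0" if "c \<in> insert b T" for c
  proof (cases "c = b")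
    case True
    then show ?thesis by (simp add: uv(4) push_diff \<rho>'_def)
  next
    case False
    then have "c \<in> T" using that by simp
    then obtain x y where xy: "c = var x - var y" using insert.prems by auto
    have "\<rho> x = \<rho> y"
      using T[OF \<open>c \<in> T\<close>] by (simp add: xy push_diff)
    then show ?thesis by (simp add: xy push_diff \<rho>'_def)
  qed
  moreover have "\<rho>' x \<in> A \<and> \<psi> (\<rho>' x) = \<psi> x" if "x \<in> A" for x
    using \<rho>[OF that] \<rho>[OF uv(1)] \<rho>[OF uv(2)] uv(3) by (auto simp: \<rho>'_def)
  ultimately show ?case by (intro exI[of _ \<rho>']) blast
qed

text \<open>Congruence modulo \<open>K\<close> passes from variables to products of them, because
  \<open>s t - s' t' = s (t - t') + t' (s - s')\<close>, and from monomials to polynomials by linearity.\<close>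

lemma diff_rename_in_ideal:
  fixes K :: "('v, 'k::field) mpoly set"
  assumes K: "ideal K (poly_ring A)"
    and \<rho>: "\<And>x. x \<in> A \<Longrightarrow> \<rho> x \<in> A \<and> var x - var (\<rho> x) \<in> K"
    and f: "f \<in> carrier (poly_ring A)"
  shows "f - rename \<rho> f \<in> K"
proof -
  let ?x = "\<lambda>m. Poly_Mapping.single m 1 :: ('v, 'k) mpoly"
  note K_simps = poly_ring_ideal[OF K]
  have push_A: "Poly_Mapping.keys (push \<rho> m) \<subseteq> A" if "Poly_Mapping.keys m \<subseteq> A" for m :: "'v \<Rightarrow>\<^sub>0 nat"
    using keys_push[of \<rho> m] that \<rho> by blast
  have mono_add: "?x (m + m') - ?x (push \<rho> (m + m')) \<in> K"
    if "Poly_Mapping.keys m \<subseteq> A" "Poly_Mapping.keys m' \<subseteq> A"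
      "?x m - ?x (push \<rho> m) \<in> K" "?x m' - ?x (push \<rho> m') \<in> K" for m m'
  proof -
    have "?x (m + m') - ?x (push \<rho> (m + m')) =
        ?x m * (?x m' - ?x (push \<rho> m')) + ?x (push \<rho> m') * (?x m - ?x (push \<rho> m))"
      by (simp add: algebra_simps mult_single push_add)
    also have "\<dots> \<in> K"
      by (intro K_simps(2,3) single_in_poly_ring push_A that)
    finally show ?thesis .
  qed
  have keys_add_nat: "Poly_Mapping.keys (m + m') = Poly_Mapping.keys m \<union> Poly_Mapping.keys m'"
    for m m' :: "'v \<Rightarrow>\<^sub>0 nat"
    by (auto simp: in_keys_iff lookup_add)
  have mono: "Poly_Mapping.keys m \<subseteq> A \<longrightarrow> ?x m - ?x (push \<rho> m) \<in> K" for m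
  proof (induction m rule: poly_mapping_additive_induct)
    case (single x k)
    show ?case
    proof (induction k)
      case 0
      show ?case by (simp add: K_simps(1))
    next
      case (Suc k)
      show ?case
      proof
        assume "Poly_Mapping.keys (Poly_Mapping.single x (Suc k)) \<subseteq> A"
        then have x: "x \<in> A" by simp
        then have xk: "Poly_Mapping.keys (Poly_Mapping.single x k) \<subseteq> A" for k :: nat
          using keys_single[of x k] by (auto split: if_splits)
        have "?x (Poly_Mapping.single x 1 + Poly_Mapping.single x k)
            - ?x (push \<rho> (Poly_Mapping.single x 1 + Poly_Mapping.single x k)) \<in> K"
          using Suc x xk \<rho>[OF x] by (intro mono_add) (auto simp: var_def)
        then show "?x (Poly_Mapping.single x (Suc k)) - ?x (push \<rho> (Poly_Mapping.single x (Suc k))) \<in> K"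
          by (simp flip: single_add)
      qed
    qed
  next
    case (add m m')
    then show ?case using mono_add[of m m'] by (simp add: keys_add_nat)
  qed
  have "f - rename \<rho> f = (\<Sum>m\<in>Poly_Mapping.keys f.
      Poly_Mapping.single 0 (Poly_Mapping.lookup f m) * (?x m - ?x (push \<rho> m)))"
    by (subst poly_mapping_sum_single[of f])
      (simp add: push_def[of "push \<rho>"] sum_subtractf right_diff_distrib mult_single)
  also have "\<dots> \<in> K"
    using f mono by (intro K_simps(3,6)) (auto simp: poly_ring_carrier_iff)
  finally show ?thesis .
qed

text \<open>The exponents of the monomials in the ideal generated by the monomials in \<open>G\<close> after substitution
  along \<open>\<rho>\<close>.\<close>

definition renamed_multiples :: "('v \<Rightarrow> 'v) \<Rightarrow> ('v \<Rightarrow>\<^sub>0 nat) set \<Rightarrow> ('v \<Rightarrow>\<^sub>0 nat) set"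
  where "renamed_multiples \<rho> G = {push \<rho> g + m | g m. g \<in> G}"

text \<open>The polynomials that satisfy the right-hand side form an ideal containing all generators. For the
  converse, \<open>f\<close> is congruent to its substitution modulo the ideal, and so is each generator to its own; hence
  the substituted \<open>f\<close>, a combination of multiples of substituted generators, is in the ideal, and so is
  \<open>f\<close>.\<close>

lemma in_genideal_iff_rename:
  fixes T :: "('v, 'k::field) mpoly set"
  assumes G: "\<And>g. g \<in> G \<Longrightarrow> Poly_Mapping.keys g \<subseteq> A"
    and T: "T \<subseteq> carrier (poly_ring A)" "\<And>b. b \<in> T \<Longrightarrow> rename \<rho> b = 0"
    and \<rho>: "\<And>x. x \<in> A \<Longrightarrow> \<rho> x \<in> A \<and> var x - var (\<rho> x) \<in> poly.span T"
    and f: "f \<in> carrier (poly_ring A)"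
  shows "f \<in> genideal (poly_ring A)
      (genideal (poly_ring A) {Poly_Mapping.single g 1 | g. g \<in> G} \<union> T) \<longleftrightarrow>
    Poly_Mapping.keys (rename \<rho> f) \<subseteq> renamed_multiples \<rho> G"
proof -
  let ?S = "poly_ring A :: ('v, 'k) mpoly ring"
  let ?E = "renamed_multiples \<rho> G"
  let ?gens = "{Poly_Mapping.single g (1::'k) | g. g \<in> G}"
  let ?I = "{f \<in> carrier ?S. Poly_Mapping.keys (rename \<rho> f) \<subseteq> ?E}"
  interpret cring ?S by (rule cring_poly_ring)
  have gens: "?gens \<subseteq> carrier ?S" using G by auto
  define L where "L = genideal ?S ?gens"
  have L: "ideal L ?S" "?gens \<subseteq> L"
    unfolding L_def by (rule genideal_ideal[OF gens]) (rule genideal_self[OF gens])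
  then have LT: "L \<union> T \<subseteq> carrier ?S"
    using T(1) additive_subgroup.a_subset[OF ideal.axioms(1)[OF L(1)]] by auto
  define K where "K = genideal ?S (L \<union> T)"
  have K: "ideal K ?S" "L \<union> T \<subseteq> K"
    unfolding K_def by (rule genideal_ideal[OF LT]) (rule genideal_self[OF LT])
  note K_simps = poly_ring_ideal[OF K(1)]
  have E_add: "m + m' \<in> ?E" if "m \<in> ?E" for m m'
    using that add.assoc unfolding renamed_multiples_def by blast
  have I_mult: "Poly_Mapping.keys (rename \<rho> (h * f)) \<subseteq> ?E"
    if "Poly_Mapping.keys (rename \<rho> f) \<subseteq> ?E" for f h :: "('v, 'k) mpoly"
  proof
    fix m assume "m \<in> Poly_Mapping.keys (rename \<rho> (h * f))"
    then obtain a b where "m = a + b" "b \<in> Poly_Mapping.keys (rename \<rho> f)"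
      using keys_mult[of "rename \<rho> h" "rename \<rho> f"] by (auto simp: push_mult push_add)
    then show "m \<in> ?E" using that E_add[of b a] by (auto simp: add.commute)
  qed
  have I_add: "Poly_Mapping.keys (rename \<rho> (f + g)) \<subseteq> ?E"
    if "Poly_Mapping.keys (rename \<rho> f) \<subseteq> ?E" "Poly_Mapping.keys (rename \<rho> g) \<subseteq> ?E"
    for f g :: "('v, 'k) mpoly"
    using that Poly_Mapping.keys_add[of "rename \<rho> f" "rename \<rho> g"] by (auto simp: push_add)
  have I: "ideal ?I ?S"
  proof (rule idealI)
    show "subgroup ?I (add_monoid ?S)"
    proof (rule add.subgroupI)
      fix f assume f: "f \<in> ?I"
      have "Poly_Mapping.single 0 (-1) * f + f = 0"
        by (simp add: single_uminus)
      then have "\<ominus>\<^bsub>?S\<^esub> f = Poly_Mapping.single 0 (-1) * f"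
        using f m_closed[OF single_in_poly_ring[of 0 A "-1"], of f]
        by (intro minus_equality) auto
      then show "\<ominus>\<^bsub>?S\<^esub> f \<in> ?I" using f I_mult a_inv_closed[of f] by auto
    next
      have "0 \<in> ?I" using zero_closed by simp
      then show "?I \<noteq> {}" by blast
    next
      fix f g assume "f \<in> ?I" "g \<in> ?I"
      then show "f \<oplus>\<^bsub>?S\<^esub> g \<in> ?I" using I_add a_closed[of f g] by simp
    qed simp
  next
    fix f h assume "f \<in> ?I" "h \<in> carrier ?S"
    then show "h \<otimes>\<^bsub>?S\<^esub> f \<in> ?I" using I_mult m_closed[of h f] by simp
    then show "f \<otimes>\<^bsub>?S\<^esub> h \<in> ?I" by (simp add: mult.commute)
  qed (rule ring_axioms)
  have "push \<rho> g \<in> ?E" if "g \<in> G" for g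
    using that add_0_right[of "push \<rho> g"] unfolding renamed_multiples_def
    by (metis (mono_tags, lifting) mem_Collect_eq)
  then have "?gens \<subseteq> ?I" using gens by auto
  then have "L \<subseteq> ?I" unfolding L_def by (rule genideal_minimal[OF I])
  moreover have "T \<subseteq> ?I" using T by auto
  ultimately have K_sub: "K \<subseteq> ?I"
    unfolding K_def by (intro genideal_minimal[OF I]) blast
  have "poly.span T \<subseteq> K"
    using K K_simps(4) by (intro poly.span_minimal) auto
  then have diff: "g - rename \<rho> g \<in> K" if "g \<in> carrier ?S" for g
    using that \<rho> by (intro diff_rename_in_ideal[OF K(1)]) auto
  have "f \<in> K" if keys: "Poly_Mapping.keys (rename \<rho> f) \<subseteq> ?E"
  proof -
    have carrier: "Poly_Mapping.keys m \<subseteq> A" if "m \<in> Poly_Mapping.keys (rename \<rho> f)" for m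
      using that f \<rho> subsetD[OF keys_push that] keys_push unfolding poly_ring_carrier_iff by fastforce
    have "Poly_Mapping.single m c \<in> K" if m: "m \<in> Poly_Mapping.keys (rename \<rho> f)" for m and c :: 'k
    proof -
      obtain g m' where g: "g \<in> G" "m = push \<rho> g + m'"
        using m keys unfolding renamed_multiples_def by auto
      have "Poly_Mapping.keys m' \<subseteq> A"
        using carrier[OF m] unfolding g(2) by (auto simp: in_keys_iff lookup_add)
      moreover have "Poly_Mapping.single (push \<rho> g) 1 \<in> K"
      proof -
        have "Poly_Mapping.single g 1 \<in> K" using K(2) L(2) g(1) by blast
        moreover have "Poly_Mapping.single g 1 - Poly_Mapping.single (push \<rho> g) 1 \<in> K"
          using diff[OF single_in_poly_ring[OF G[OF g(1)]], of 1] by simp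
        ultimately show ?thesis using K_simps(5) by fastforce
      qed
      ultimately have "Poly_Mapping.single m' c * Poly_Mapping.single (push \<rho> g) 1 \<in> K"
        by (intro K_simps(3)) auto
      then show ?thesis by (simp add: mult_single g(2) add.commute)
    qed
    then have "rename \<rho> f \<in> K"
      by (subst poly_mapping_sum_single) (rule K_simps(6))
    then show "f \<in> K"
      using K_simps(2)[OF diff[OF f]] by fastforce
  qed
  then show ?thesis
    using K_sub unfolding K_def L_def by blast
qed

section \<open>Exchange for co-letterplace monomials\<close>

definition graph_monomial :: "'p gorder \<Rightarrow> ('p \<Rightarrow> nat) \<Rightarrow> ('p \<times> nat) \<Rightarrow>\<^sub>0 nat"
  where "graph_monomial P \<phi> = (\<Sum>p\<in>carrier P. Poly_Mapping.single (p, \<phi> p) 1)"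

lemma keys_graph_monomial:
  "Poly_Mapping.keys (graph_monomial P \<phi>) \<subseteq> (\<lambda>p. (p, \<phi> p)) ` carrier P"
  unfolding graph_monomial_def by (rule order_trans[OF keys_sum]) auto

lemma lookup_push_graph_monomial:
  assumes "finite (carrier P)"
  shows "Poly_Mapping.lookup (push \<rho> (graph_monomial P \<phi>)) w = card {p \<in> carrier P. \<rho> (p, \<phi> p) = w}"
proof -
  have "Poly_Mapping.lookup (push \<rho> (graph_monomial P \<phi>)) w =
      (\<Sum>p\<in>carrier P. if \<rho> (p, \<phi> p) = w then 1 else 0)"
    by (simp add: graph_monomial_def push_sum lookup_sum lookup_single when_def cong: if_cong)
  also have "\<dots> = card {p \<in> carrier P. \<rho> (p, \<phi> p) = w}"
    by (simp only: card_eq_sum sum.inter_filter[OF assms])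
  finally show ?thesis .
qed

lemma prod_var_eq_graph_monomial:
  assumes "finite (carrier P)"
  shows "(\<Prod>p\<in>carrier P. var (p, \<phi> p)) = Poly_Mapping.single (graph_monomial P \<phi>) (1::'k::field)"
proof -
  have "(\<Prod>p\<in>A. var (p, \<phi> p)) =
      Poly_Mapping.single (\<Sum>p\<in>A. Poly_Mapping.single (p, \<phi> p) 1) (1::'k)" if "finite A" for A
    using that by (induction A rule: finite_induct) (simp_all add: var_def mult_single)
  then show ?thesis using assms by (simp add: graph_monomial_def)
qed

lemma renamed_multiples_iff:
  "m \<in> renamed_multiples \<rho> G \<longleftrightarrow>
    (\<exists>g\<in>G. \<forall>w. Poly_Mapping.lookup (push \<rho> g) w \<le> Poly_Mapping.lookup m w)"
proof
  assume "m \<in> renamed_multiples \<rho> G"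
  then obtain g m' where "g \<in> G" "m = push \<rho> g + m'"
    unfolding renamed_multiples_def by blast
  then show "\<exists>g\<in>G. \<forall>w. Poly_Mapping.lookup (push \<rho> g) w \<le> Poly_Mapping.lookup m w"
    by (intro bexI[of _ g]) (simp_all add: lookup_add)
next
  assume "\<exists>g\<in>G. \<forall>w. Poly_Mapping.lookup (push \<rho> g) w \<le> Poly_Mapping.lookup m w"
  then obtain g where "g \<in> G" "\<And>w. Poly_Mapping.lookup (push \<rho> g) w \<le> Poly_Mapping.lookup m w"
    by blast
  moreover from this have "m = push \<rho> g + (m - push \<rho> g)"
    by (intro poly_mapping_eqI) (simp add: lookup_add lookup_minus)
  ultimately show "m \<in> renamed_multiples \<rho> G"
    unfolding renamed_multiples_def by blast
qed

text \<open>The exponent of \<open>w\<close> in the substituted monomial of \<open>\<phi>\<close> is the number of points that the graph of \<open>\<phi>\<close>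
  has in the class \<open>\<rho>\<^sup>-\<^sup>1 w\<close>. If neither \<open>m1\<close> nor \<open>m2\<close> is in \<open>E\<close>, the witness \<open>\<phi>1\<close> for \<open>m1 x\<^sub>a\<close> uses up
  the full exponent at \<open>a\<close>, and the witness \<open>\<phi>2\<close> for \<open>m2 x\<^sub>c\<close> the full exponent at \<open>c\<close>. So \<open>\<phi>1\<close> has
  more points than \<open>\<phi>2\<close> in class \<open>a\<close> and fewer in class \<open>c\<close>, which provides the points \<open>u\<close> and \<open>v\<close> to
  be avoided.\<close>

lemma graph_monomial_exchange:
  fixes \<psi> :: "'p \<times> nat \<Rightarrow> 'r" and \<rho> :: "'p \<times> nat \<Rightarrow> 'p \<times> nat"
  assumes P: "partial_order P" and fin: "finite (carrier P)"
    and fibers: "left_strict_chain_fibers P n R \<psi>"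
    and \<psi>: "\<psi> \<in> carrier (prod_order P (nat_chain n)) \<rightarrow> carrier R"
    and \<rho>: "\<And>x. x \<in> carrier (prod_order P (nat_chain n)) \<Longrightarrow> \<psi> (\<rho> x) = \<psi> x"
    and ac: "a \<noteq> c" "\<psi> a = \<psi> c"
    and E: "E = renamed_multiples \<rho> (graph_monomial P ` Hom_poset P (nat_chain n))"
    and m1: "m1 + Poly_Mapping.single a 1 \<in> E" and m2: "m2 + Poly_Mapping.single c 1 \<in> E"
    and off: "\<And>w. w \<noteq> a \<Longrightarrow> w \<noteq> c \<Longrightarrow> Poly_Mapping.lookup m1 w = Poly_Mapping.lookup m2 w"
    and le: "Poly_Mapping.lookup m2 a \<le> Poly_Mapping.lookup m1 a"
      "Poly_Mapping.lookup m1 c \<le> Poly_Mapping.lookup m2 c"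
  shows "m1 \<in> E \<or> m2 \<in> E"
proof (rule ccontr)
  assume notE: "\<not> ?thesis"
  let ?X = "carrier (prod_order P (nat_chain n))"
  let ?H = "Hom_poset P (nat_chain n)"
  let ?l = Poly_Mapping.lookup
  define S where "S = (\<lambda>\<phi> w. {p \<in> carrier P. \<rho> (p, \<phi> p) = w})"
  define F where "F = (\<lambda>w. {x \<in> ?X. \<psi> x = \<psi> w})"
  have finS: "finite (S \<phi> w)" for \<phi> w using fin by (simp add: S_def)
  have E_iff: "m \<in> E \<longleftrightarrow> (\<exists>\<phi>\<in>?H. \<forall>w. card (S \<phi> w) \<le> ?l m w)" for m
    unfolding E renamed_multiples_iff S_def by (simp add: lookup_push_graph_monomial[OF fin])
  have graph: "(p, \<phi> p) \<in> ?X" if "\<phi> \<in> ?H" "p \<in> carrier P" for \<phi> p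
    using that by (auto simp: Hom_poset_def prod_order_def)
  have SF: "(p, \<phi> p) \<in> F w" if "\<phi> \<in> ?H" "p \<in> S \<phi> w" for \<phi> p w
    using that graph[of \<phi> p] \<rho>[of "(p, \<phi> p)"] by (auto simp: S_def F_def)
  obtain \<phi>1 where \<phi>1: "\<phi>1 \<in> ?H" "\<And>w. card (S \<phi>1 w) \<le> ?l m1 w + (1 when a = w)"
    using m1 unfolding E_iff by (auto simp: lookup_add lookup_single)
  obtain \<phi>2 where \<phi>2: "\<phi>2 \<in> ?H" "\<And>w. card (S \<phi>2 w) \<le> ?l m2 w + (1 when c = w)"
    using m2 unfolding E_iff by (auto simp: lookup_add lookup_single)
  have "card (S \<phi>1 a) > ?l m1 a"
  proof (rule ccontr)
    assume "\<not> card (S \<phi>1 a) > ?l m1 a"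
    then have "card (S \<phi>1 w) \<le> ?l m1 w" for w
      using \<phi>1(2)[of w] by (cases "w = a") auto
    then show False using notE \<phi>1(1) unfolding E_iff by blast
  qed
  moreover have "card (S \<phi>2 a) \<le> ?l m2 a" using \<phi>2(2)[of a] ac by simp
  ultimately have "\<not> S \<phi>1 a \<subseteq> S \<phi>2 a"
    using le card_mono[OF finS, of "S \<phi>1 a" \<phi>2 a] by auto
  then obtain u where u: "u \<in> S \<phi>1 a" "u \<notin> S \<phi>2 a" by blast
  have "card (S \<phi>2 c) > ?l m2 c"
  proof (rule ccontr)
    assume "\<not> card (S \<phi>2 c) > ?l m2 c"
    then have "card (S \<phi>2 w) \<le> ?l m2 w" for w
      using \<phi>2(2)[of w] by (cases "w = c") auto
    then show False using notE \<phi>2(1) unfolding E_iff by blast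
  qed
  moreover have "card (S \<phi>1 c) \<le> ?l m1 c" using \<phi>1(2)[of c] ac by simp
  ultimately have "\<not> S \<phi>2 c \<subseteq> S \<phi>1 c"
    using le card_mono[OF finS, of "S \<phi>2 c" \<phi>1 c] by auto
  then obtain v where v: "v \<in> S \<phi>2 c" "v \<notin> S \<phi>1 c" by blast
  have chain: "left_strict_chain P (inv_gorder (nat_chain n)) (F w)" if "\<psi> w \<in> carrier R" for w
    using fibers that unfolding left_strict_chain_fibers_def F_def by blast
  have Fa: "(u, \<phi>1 u) \<in> F a" "(v, \<phi>2 v) \<in> F a"
    using SF[OF \<phi>1(1) u(1)] SF[OF \<phi>2(1) v(1)] ac by (auto simp: F_def)
  have \<psi>F: "\<psi> w \<in> carrier R" if "x \<in> F w" for x w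
    using that Pi_mem[OF \<psi>, of x] by (simp add: F_def)
  have ne: "\<phi>1 u \<noteq> \<phi>2 u" "\<phi>1 v \<noteq> \<phi>2 v" "(u, \<phi>1 u) \<noteq> (v, \<phi>2 v)"
    using u v ac(1) by (auto simp: S_def)
  obtain \<chi> where \<chi>: "\<chi> \<in> ?H" "\<chi> u \<noteq> \<phi>1 u" "\<chi> v \<noteq> \<phi>2 v"
    "\<And>G. left_strict_chain P (inv_gorder (nat_chain n)) G \<Longrightarrow>
      (\<forall>p. (p, \<chi> p) \<in> G \<longrightarrow> \<chi> p = \<phi>1 p) \<or> (\<forall>p. (p, \<chi> p) \<in> G \<longrightarrow> \<chi> p = \<phi>2 p)"
    using exchange_isotone[OF P chain[OF \<psi>F[OF Fa(1)]] \<phi>1(1) \<phi>2(1) Fa(1) ne(1) Fa(2) ne(2,3)]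
    by blast
  have sub: "S \<chi> w \<subseteq> {p \<in> S \<phi> w. \<chi> p = \<phi> p}"
    if "\<forall>p. (p, \<chi> p) \<in> F w \<longrightarrow> \<chi> p = \<phi> p" for \<phi> w
  proof
    fix p assume p: "p \<in> S \<chi> w"
    then have "\<chi> p = \<phi> p" using that SF[OF \<chi>(1)] by blast
    then show "p \<in> {p \<in> S \<phi> w. \<chi> p = \<phi> p}" using p by (simp add: S_def)
  qed
  have off_le: "card (S \<chi> w) \<le> ?l m1 w" if "w \<noteq> a" "w \<noteq> c" for w
  proof (cases "S \<chi> w = {}")
    case False
    then have "left_strict_chain P (inv_gorder (nat_chain n)) (F w)"
      using \<psi>F[OF SF[OF \<chi>(1)]] by (intro chain) blast
    then have "card (S \<chi> w) \<le> card (S \<phi>1 w) \<or> card (S \<chi> w) \<le> card (S \<phi>2 w)"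
      using \<chi>(4)[of "F w"] sub[of w \<phi>1] sub[of w \<phi>2]
      by (auto intro!: card_mono finS)
    then show ?thesis
      using \<phi>1(2)[of w] \<phi>2(2)[of w] off[OF that] that by auto
  qed simp
  have Fac: "F c = F a" using ac by (simp add: F_def)
  \<comment> \<open>The classes of \<open>a\<close> and \<open>c\<close> lie in the same fiber, so \<open>\<chi>\<close> follows the same map on both. It has
  fewer points than that map in class \<open>a\<close> or in class \<open>c\<close>, respectively, because it avoids \<open>u\<close> and \<open>v\<close>.\<close>
  consider "\<forall>p. (p, \<chi> p) \<in> F a \<longrightarrow> \<chi> p = \<phi>1 p" | "\<forall>p. (p, \<chi> p) \<in> F a \<longrightarrow> \<chi> p = \<phi>2 p"
    using \<chi>(4)[OF chain[OF \<psi>F[OF Fa(1)]]] by blast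
  then show False
  proof cases
    case 1
    have "S \<chi> a \<subset> S \<phi>1 a" using sub[of a \<phi>1] 1 u(1) \<chi>(2) by auto
    then have "card (S \<chi> a) < card (S \<phi>1 a)" by (rule psubset_card_mono[OF finS])
    moreover have "card (S \<chi> c) \<le> card (S \<phi>1 c)"
      using sub[of c \<phi>1] 1 by (intro card_mono finS) (auto simp: Fac)
    ultimately have "card (S \<chi> w) \<le> ?l m1 w" for w
      using off_le[of w] \<phi>1(2)[of a] \<phi>1(2)[of c] ac(1) by (cases "w = a \<or> w = c") auto
    then show False using notE \<chi>(1) unfolding E_iff by blast
  next
    case 2
    have "S \<chi> c \<subset> S \<phi>2 c" using sub[of c \<phi>2] 2 v(1) \<chi>(3) by (auto simp: Fac)
    then have "card (S \<chi> c) < card (S \<phi>2 c)" by (rule psubset_card_mono[OF finS])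
    moreover have "card (S \<chi> a) \<le> card (S \<phi>2 a)"
      using sub[of a \<phi>2] 2 by (intro card_mono finS) auto
    ultimately have "card (S \<chi> w) \<le> ?l m2 w" for w
      using off_le[of w] off[of w] \<phi>2(2)[of a] \<phi>2(2)[of c] ac(1) by (cases "w = a \<or> w = c") auto
    then show False using notE \<chi>(1) unfolding E_iff by blast
  qed
qed

section \<open>The regular sequence\<close>

theorem theorem2p2:
  fixes P :: "'p gorder" and R :: "'r gorder" and n :: nat
    and \<psi> :: "'p \<times> nat \<Rightarrow> 'r"
    and \<psi>\<^sub>1 :: "('p \<times> nat, 'k::field) mpoly \<Rightarrow> ('r, 'k) mpoly"
    and B :: "('p \<times> nat, 'k) mpoly list"
  assumes "n \<ge> 1"
    and "partial_order P" and "finite (carrier P)"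
    and "partial_order R"
    and "\<psi> \<in> carrier (prod_order P (nat_chain n)) \<rightarrow> carrier R"
    and "isotone (prod_order P (nat_chain n)) R \<psi>"
    and "left_strict_chain_fibers P n R \<psi>"
    and "linear_between (linear_forms (carrier (prod_order P (nat_chain n))))
           (linear_forms (carrier R)) \<psi>\<^sub>1"
    and "\<forall>x\<in>carrier (prod_order P (nat_chain n)). \<psi>\<^sub>1 (var x) = var (\<psi> x)"
    and "distinct B"
    and "is_basis_of (set B)
           (kernel_on (linear_forms (carrier (prod_order P (nat_chain n)))) \<psi>\<^sub>1)"
    and "\<forall>b\<in>set B. \<exists>x\<in>carrier (prod_order P (nat_chain n)).
           \<exists>x'\<in>carrier (prod_order P (nat_chain n)). \<psi> x = \<psi> x' \<and> b = var x - var x'"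
  shows "regular_sequence (coletterplace_ring P n Quot coletterplace_ideal P n)
           (map (\<lambda>b. coletterplace_ideal P n +>\<^bsub>coletterplace_ring P n\<^esub> b) B)"
proof -
  let ?X = "carrier (prod_order P (nat_chain n))"
  let ?S = "poly_ring ?X :: ('p \<times> nat, 'k) mpoly ring"
  let ?G = "graph_monomial P ` Hom_poset P (nat_chain n)"
  let ?L = "genideal ?S {Poly_Mapping.single g 1 | g. g \<in> ?G}"
  interpret cring ?S by (rule cring_poly_ring)
  have G: "Poly_Mapping.keys g \<subseteq> ?X" if "g \<in> ?G" for g
    using that subsetD[OF keys_graph_monomial]
    by (fastforce simp: Hom_poset_def prod_order_def)
  have L: "coletterplace_ideal P n = ?L"
  proof -
    have "{\<Prod>p\<in>carrier P. var (p, \<phi> p) | \<phi>. \<phi> \<in> Hom_poset P (nat_chain n)} =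
        {Poly_Mapping.single g (1::'k) | g. g \<in> ?G}"
      by (auto simp: prod_var_eq_graph_monomial[OF assms(3)])
    then show ?thesis by (simp add: coletterplace_ideal_def coletterplace_ring_def)
  qed
  have B_carrier: "set B \<subseteq> carrier ?S"
  proof
    fix b assume "b \<in> set B"
    then obtain x y where "x \<in> ?X" "y \<in> ?X" "b = var x - var y"
      using assms(12) by blast
    then show "b \<in> carrier ?S" by (simp add: var_diff_in_poly_ring)
  qed
  have "regular_sequence (?S Quot ?L) (map (\<lambda>b. ?L +>\<^bsub>?S\<^esub> b) B)"
  proof (rule regular_sequence_QuotI)
    show "ideal ?L ?S"
      using G by (intro genideal_ideal) auto
    show "set B \<subseteq> carrier ?S" by (rule B_carrier)
    fix i f
    assume i: "i < length B" and f: "f \<in> carrier ?S"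
      and bf: "B ! i \<otimes>\<^bsub>?S\<^esub> f \<in> genideal ?S (?L \<union> set (take i B))"
    let ?T = "set (take i B)"
    have T: "?T \<subseteq> set B" by (rule set_take_subset)
    obtain \<rho> where \<rho>: "\<And>x. x \<in> ?X \<Longrightarrow> \<rho> x \<in> ?X \<and> \<psi> (\<rho> x) = \<psi> x \<and> var x - var (\<rho> x) \<in> poly.span ?T"
      and \<rho>T: "\<And>b. b \<in> ?T \<Longrightarrow> rename \<rho> b = 0"
      using identification_exists[of ?T ?X \<psi>] assms(12) T by blast
    have mem: "h \<in> genideal ?S (?L \<union> ?T) \<longleftrightarrow>
        Poly_Mapping.keys (rename \<rho> h) \<subseteq> renamed_multiples \<rho> ?G" if "h \<in> carrier ?S" for h
      using G T B_carrier \<rho>T \<rho> that by (intro in_genideal_iff_rename) auto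
    obtain u v where uv: "u \<in> ?X" "v \<in> ?X" "\<psi> u = \<psi> v" "B ! i = var u - var v"
      using assms(12) i nth_mem by blast
    have "\<rho> u \<noteq> \<rho> v"
    proof
      assume "\<rho> u = \<rho> v"
      then have "B ! i \<in> poly.span ?T"
        using poly.span_diff[of "var u - var (\<rho> u)" ?T "var v - var (\<rho> v)"]
          \<rho>[OF uv(1)] \<rho>[OF uv(2)] uv(4) by simp
      moreover have "?T \<subseteq> set B - {B ! i}"
        using T i \<open>distinct B\<close> by (auto simp: in_set_conv_nth distinct_conv_nth)
      ultimately have "poly.dependent (set B)"
        using poly.span_mono i nth_mem[OF i] unfolding poly.dependent_def by blast
      then show False using assms(11) by (simp add: is_basis_of_def)
    qed
    have "Poly_Mapping.keys (rename \<rho> f) \<subseteq> renamed_multiples \<rho> ?G"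
    proof (rule binomial_nonzerodivisor)
      show "\<rho> u \<noteq> \<rho> v" by fact
      have "B ! i * f \<in> carrier ?S"
        using m_closed[OF subsetD[OF B_carrier nth_mem[OF i]] f] by simp
      then show "Poly_Mapping.keys ((var (\<rho> u) - var (\<rho> v)) * rename \<rho> f) \<subseteq> renamed_multiples \<rho> ?G"
        using mem[of "B ! i * f"] bf by (simp add: uv(4) push_mult push_add push_diff)
      show "m + m' \<in> renamed_multiples \<rho> ?G" if "m \<in> renamed_multiples \<rho> ?G" for m m'
        using that add.assoc unfolding renamed_multiples_def by blast
      show "m1 \<in> renamed_multiples \<rho> ?G \<or> m2 \<in> renamed_multiples \<rho> ?G"
        if "m1 + Poly_Mapping.single (\<rho> u) 1 \<in> renamed_multiples \<rho> ?G"
          "m2 + Poly_Mapping.single (\<rho> v) 1 \<in> renamed_multiples \<rho> ?G"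
          "\<And>w. w \<noteq> \<rho> u \<Longrightarrow> w \<noteq> \<rho> v \<Longrightarrow> Poly_Mapping.lookup m1 w = Poly_Mapping.lookup m2 w"
          "Poly_Mapping.lookup m2 (\<rho> u) \<le> Poly_Mapping.lookup m1 (\<rho> u)"
          "Poly_Mapping.lookup m1 (\<rho> v) \<le> Poly_Mapping.lookup m2 (\<rho> v)" for m1 m2
        using that \<open>\<rho> u \<noteq> \<rho> v\<close> \<rho> uv
        by (intro graph_monomial_exchange[OF assms(2,3,7,5) _ _ _ refl, of \<rho> "\<rho> u" "\<rho> v"]) simp_all
    qed
    then show "f \<in> genideal ?S (?L \<union> ?T)" using mem[OF f] by simp
  qed
  then show ?thesis by (simp add: L coletterplace_ring_def)
qed

end
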